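(* Let $V_1, V_2$ be real vector spaces with a bilinear pairing $\langle\,,\,\rangle\colon V_1\times V_2\to\mathbb{R}$, let $S$ be an indexing set, and let $\Pi_1=\{\alpha_s\mid s\in S\}\subseteq V_1$ and $\Pi_2=\{\beta_s\mid s\in S\}\subseteq V_2$ both be in bijective correspondence with $S$ (via $s\mapsto\alpha_s$ and $s\mapsto\beta_s$). Suppose that $\langle\alpha_s,\beta_s\rangle=1$ for all $s\in S$; that $0\notin\mathrm{PLC}(\Pi_1)$ and $0\notin\mathrm{PLC}(\Pi_2)$; and that $\alpha_s\notin\mathrm{PLC}(\Pi_1\setminus\{\alpha_s\})$ and $\beta_s\notin\mathrm{PLC}(\Pi_2\setminus\{\beta_s\})$ for each $s\in S$. Let $\Phi_i,\Phi_i^+,\Phi_i^-$ ($i=1,2$) be the associated root systems and sets of positive and negative roots. Then the following are equivalent: (i) $\Phi_1=\Phi_1^+\uplus\Phi_1^-$ (disjoint union). (ii) $\Phi_2=\Phi_2^+\uplus\Phi_2^-$ (disjoint union). (iii) For all $s,t\in S$ the following three conditions hold: (a) $\langle\alpha_s,\beta_t\rangle\le 0$ and $\langle\alpha_t,\beta_s\rangle\le 0$ whenever $s\ne t$; (b) $\langle\alpha_s,\beta_t\rangle=0$ if and only if $\langle\alpha_t,\beta_s\rangle=0$; (c) either $\langle\alpha_s,\beta_t\rangle\langle\alpha_t,\beta_s\rangle=\cos^2\frac{\pi}{m_{st}}$ for some integer $m_{st}\ge 2$, or else $\langle\alpha_s,\beta_t\rangle\langle\alpha_t,\beta_s\rangle\ge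 1$.
   Context: For a subset $A$ of a real vector space, $\mathrm{PLC}(A)$ is the set of all (finite) linear combinations $\sum_{a\in A}c_a a$ with all $c_a\ge 0$ and at least one $c_{a'}>0$. For $s\in S$ define $\rho_1(s)\in\mathrm{GL}(V_1)$ and $\rho_2(s)\in\mathrm{GL}(V_2)$ by $\rho_1(s)(x)=x-2\langle x,\beta_s\rangle\alpha_s$ for $x\in V_1$ and $\rho_2(s)(y)=y-2\langle\alpha_s,y\rangle\beta_s$ for $y\in V_2$. For $i\in\{1,2\}$: $W_i=\langle\rho_i(s)\mid s\in S\rangle\le \mathrm{GL}(V_i)$; $\Phi_i=W_i\Pi_i=\{wz\mid w\in W_i,\ z\in\Pi_i\}$ (the root system); $\Phi_i^+=\Phi_i\cap\mathrm{PLC}(\Pi_i)$ (positive roots); $\Phi_i^-=-\Phi_i^+=\{-v\mid v\in\Phi_i^+\}$ (negative roots). *)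

theory Defs
  imports "HOL-Analysis.Analysis" "HOL-Algebra.Generated_Groups"
begin

definition PLC :: "'v::real_vector set \<Rightarrow> 'v set" where
  "PLC A = {\<Sum>a\<in>F. c a *\<^sub>R a | F c.
     finite F \<and> F \<subseteq> A \<and> (\<forall>a\<in>F. c a \<ge> (0::real)) \<and> (\<exists>a\<in>F. c a > 0)}"

definition GL :: "('v::real_vector \<Rightarrow> 'v) monoid" where
  "GL = \<lparr>carrier = {f. linear f \<and> bij f}, mult = (\<circ>), one = id\<rparr>"

lemma group_GL: "group (GL :: ('v::real_vector \<Rightarrow> 'v) monoid)"
proof (rule groupI)
  fix f :: "'v \<Rightarrow> 'v" assume "f \<in> carrier GL"
  then have lin: "linear f" and bij: "bij f"
    by (simp_all add: GL_def)
  have inv: "inv_into UNIV f (f x) = x" "f (inv_into UNIV f x) = x" for x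
    using bij by (simp_all add: bij_is_inj bij_is_surj surj_f_inv_f)
  have "linear (inv_into UNIV f)"
  proof (rule linearI)
    fix x y :: 'v and r :: real
    have "f (inv_into UNIV f x + inv_into UNIV f y) = x + y"
      by (simp only: linear_add[OF lin] inv)
    then show "inv_into UNIV f (x + y) = inv_into UNIV f x + inv_into UNIV f y"
      by (metis inv(1))
    have "f (r *\<^sub>R inv_into UNIV f x) = r *\<^sub>R x"
      by (simp only: linear_scale[OF lin] inv)
    then show "inv_into UNIV f (r *\<^sub>R x) = r *\<^sub>R inv_into UNIV f x"
      by (metis inv(1))
  qed
  then have "inv_into UNIV f \<in> carrier GL"
    using bij by (simp add: GL_def bij_imp_bij_inv)
  moreover have "inv_into UNIV f \<otimes>\<^bsub>GL\<^esub> f = \<one>\<^bsub>GL\<^esub>"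
    by (simp add: GL_def fun_eq_iff inv)
  ultimately show "\<exists>g\<in>carrier GL. g \<otimes>\<^bsub>GL\<^esub> f = \<one>\<^bsub>GL\<^esub>"
    by blast
qed (simp_all add: GL_def linear_compose bij_comp linear_id comp_assoc)

definition rho1 :: "('v1 \<Rightarrow> 'v2 \<Rightarrow> real) \<Rightarrow> ('s \<Rightarrow> 'v1) \<Rightarrow> ('s \<Rightarrow> 'v2) \<Rightarrow>
    's \<Rightarrow> 'v1 \<Rightarrow> 'v1::real_vector" where
  "rho1 B \<alpha> \<beta> s = (\<lambda>x. x - (2 * B x (\<beta> s)) *\<^sub>R \<alpha> s)"

definition rho2 :: "('v1 \<Rightarrow> 'v2 \<Rightarrow> real) \<Rightarrow> ('s \<Rightarrow> 'v1) \<Rightarrow> ('s \<Rightarrow> 'v2) \<Rightarrow>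
    's \<Rightarrow> 'v2 \<Rightarrow> 'v2::real_vector" where
  "rho2 B \<alpha> \<beta> s = (\<lambda>y. y - (2 * B (\<alpha> s) y) *\<^sub>R \<beta> s)"

lemma rho1_in_GL:
  fixes B :: "'v1::real_vector \<Rightarrow> 'v2::real_vector \<Rightarrow> real"
  assumes "bilinear B" "B (\<alpha> s) (\<beta> s) = 1"
  shows "rho1 B \<alpha> \<beta> s \<in> carrier GL"
proof -
  have l: "linear (\<lambda>x. B x (\<beta> s))"
    using assms(1) by (simp add: bilinear_def)
  have "linear (rho1 B \<alpha> \<beta> s)"
    unfolding rho1_def
    by (rule linearI)
      (simp_all add: linear_add[OF l] linear_scale[OF l] scaleR_add_left
        scaleR_right_diff_distrib distrib_left mult_ac)
  moreover have "rho1 B \<alpha> \<beta> s (rho1 B \<alpha> \<beta> s x) = x" for x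
  proof -
    have "B (rho1 B \<alpha> \<beta> s x) (\<beta> s) = - B x (\<beta> s)"
      using assms(2) by (simp add: rho1_def linear_diff[OF l] linear_scale[OF l])
    then show ?thesis
      by (simp add: rho1_def)
  qed
  then have "rho1 B \<alpha> \<beta> s \<circ> rho1 B \<alpha> \<beta> s = id"
    by (simp add: fun_eq_iff)
  ultimately show ?thesis
    by (simp add: GL_def o_bij)
qed

lemma rho2_in_GL:
  fixes B :: "'v1::real_vector \<Rightarrow> 'v2::real_vector \<Rightarrow> real"
  assumes "bilinear B" "B (\<alpha> s) (\<beta> s) = 1"
  shows "rho2 B \<alpha> \<beta> s \<in> carrier GL"
proof -
  have "bilinear (\<lambda>y x. B x y)"
    using assms(1) by (simp add: bilinear_def)
  from rho1_in_GL[OF this, where \<alpha> = \<beta> and \<beta> = \<alpha> and s = s] show ?thesis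
    using assms(2) by (simp add: rho1_def rho2_def)
qed

definition W1 :: "('v1::real_vector \<Rightarrow> 'v2 \<Rightarrow> real) \<Rightarrow> ('s \<Rightarrow> 'v1) \<Rightarrow> ('s \<Rightarrow> 'v2) \<Rightarrow>
    's set \<Rightarrow> ('v1 \<Rightarrow> 'v1) set" where
  "W1 B \<alpha> \<beta> S = generate GL (rho1 B \<alpha> \<beta> ` S)"

definition W2 :: "('v1 \<Rightarrow> 'v2::real_vector \<Rightarrow> real) \<Rightarrow> ('s \<Rightarrow> 'v1) \<Rightarrow> ('s \<Rightarrow> 'v2) \<Rightarrow>
    's set \<Rightarrow> ('v2 \<Rightarrow> 'v2) set" where
  "W2 B \<alpha> \<beta> S = generate GL (rho2 B \<alpha> \<beta> ` S)"

definition root_system :: "('v \<Rightarrow> 'v) set \<Rightarrow> 'v set \<Rightarrow> 'v set" where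
  "root_system W P = {w z | w z. w \<in> W \<and> z \<in> P}"

definition pos_roots :: "('v::real_vector \<Rightarrow> 'v) set \<Rightarrow> 'v set \<Rightarrow> 'v set" where
  "pos_roots W P = root_system W P \<inter> PLC P"

definition neg_roots :: "('v::real_vector \<Rightarrow> 'v) set \<Rightarrow> 'v set \<Rightarrow> 'v set" where
  "neg_roots W P = uminus ` pos_roots W P"

end

theory Submission
  imports Defs
begin

text \<open>The two sides are exchanged by swapping \<open>V\<^sub>1\<close> and \<open>V\<^sub>2\<close>, and condition (iii) is symmetric, so
  it suffices to prove (i) \<open>\<longleftrightarrow>\<close> (iii). A root \<open>x \<alpha>\<^sub>s + y \<alpha>\<^sub>t\<close> with \<open>x y < 0\<close> is neither positive nor
  negative, because of the hypotheses on \<open>PLC\<close>. In rank two the coefficients of the roots are, up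
  to scaling, Chebyshev values \<open>sin (n \<theta>) / sin \<theta>\<close>; if \<open>\<pi> / \<theta>\<close> is not an integer, they change sign
  between two consecutive \<open>n\<close> and produce such a root. Conversely, if (iii) holds, induction on the
  length of a reduced word \<open>w\<close> shows that \<open>w \<alpha>\<^sub>s\<close> is positive whenever \<open>w s\<close> is not shorter than \<open>w\<close>:
  split off a dihedral factor in \<open>s\<close> and \<open>t\<close> and use the rank two formula. That factor is an
  alternating word shorter than the braid relation, which keeps the coefficients nonnegative.\<close>

section \<open>Positive linear combinations\<close>

lemma PLC_base: "a \<in> A \<Longrightarrow> a \<in> PLC A"
  unfolding PLC_def by (rule CollectI, rule exI[of _ "{a}"], rule exI[of _ "\<lambda>_. 1"]) auto

lemma PLC_scaleR:
  assumes "v \<in> PLC A" "r > 0"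
  shows "r *\<^sub>R v \<in> PLC A"
proof -
  obtain F c where F: "v = (\<Sum>a\<in>F. c a *\<^sub>R a)" "finite F" "F \<subseteq> A"
      "\<forall>a\<in>F. c a \<ge> 0" "\<exists>a\<in>F. c a > 0"
    using assms(1) unfolding PLC_def by blast
  have "r *\<^sub>R v = (\<Sum>a\<in>F. (r * c a) *\<^sub>R a)"
    by (simp add: F(1) scaleR_sum_right)
  moreover have "\<forall>a\<in>F. r * c a \<ge> 0" "\<exists>a\<in>F. r * c a > 0"
    using F(4,5) assms(2) by (simp_all add: zero_less_mult_iff)
  ultimately show ?thesis
    unfolding PLC_def using F(2,3) by (intro CollectI exI[of _ F] exI[of _ "\<lambda>a. r * c a"]) simp
qed

lemma PLC_add:
  assumes "v \<in> PLC A" "w \<in> PLC A"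
  shows "v + w \<in> PLC A"
proof -
  obtain F c where F: "v = (\<Sum>a\<in>F. c a *\<^sub>R a)" "finite F" "F \<subseteq> A"
      "\<forall>a\<in>F. c a \<ge> 0" "\<exists>a\<in>F. c a > 0"
    using assms(1) unfolding PLC_def by blast
  obtain G d where G: "w = (\<Sum>a\<in>G. d a *\<^sub>R a)" "finite G" "G \<subseteq> A"
      "\<forall>a\<in>G. d a \<ge> 0" "\<exists>a\<in>G. d a > 0"
    using assms(2) unfolding PLC_def by blast
  define e where "e a = (if a \<in> F then c a else 0) + (if a \<in> G then d a else 0)" for a
  have "v = (\<Sum>a\<in>F \<union> G. (if a \<in> F then c a else 0) *\<^sub>R a)"
    unfolding F(1) using F(2) G(2) by (intro sum.mono_neutral_cong_left) auto
  moreover have "w = (\<Sum>a\<in>F \<union> G. (if a \<in> G then d a else 0) *\<^sub>R a)"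
    unfolding G(1) using F(2) G(2) by (intro sum.mono_neutral_cong_left) auto
  ultimately have "v + w = (\<Sum>a\<in>F \<union> G. e a *\<^sub>R a)"
    by (simp add: e_def scaleR_add_left sum.distrib)
  moreover have "\<forall>a\<in>F \<union> G. e a \<ge> 0"
    using F(4) G(4) by (auto simp: e_def)
  moreover obtain b where "b \<in> F" "c b > 0"
    using F(5) by blast
  then have "b \<in> F \<union> G" "e b > 0"
    using G(4) by (auto simp: e_def intro: add_pos_nonneg)
  ultimately show ?thesis
    unfolding PLC_def using F(2,3) G(2,3)
    by (intro CollectI exI[of _ "F \<union> G"] exI[of _ e]) auto
qed

lemma PLC_mono: "A \<subseteq> B \<Longrightarrow> PLC A \<subseteq> PLC B"
  unfolding PLC_def by blast

text \<open>The coefficient of \<open>a\<close> is split off; it is 0 if \<open>a\<close> does not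
  occur. The remainder needs the case \<open>w = 0\<close> because \<open>PLC\<close> excludes
  combinations whose coefficients all vanish.\<close>

lemma PLC_split:
  assumes "v \<in> PLC A"
  obtains c w where "c \<ge> 0" "v = c *\<^sub>R a + w" "w = 0 \<or> w \<in> PLC (A - {a})"
proof -
  obtain F k where F: "v = (\<Sum>b\<in>F. k b *\<^sub>R b)" "finite F" "F \<subseteq> A"
      "\<forall>b\<in>F. k b \<ge> 0" "\<exists>b\<in>F. k b > 0"
    using assms(1) unfolding PLC_def by blast
  define w where "w = (\<Sum>b\<in>F - {a}. k b *\<^sub>R b)"
  have "w = 0 \<or> w \<in> PLC (A - {a})"
  proof (cases "\<exists>b\<in>F - {a}. k b > 0")
    case True
    then show ?thesis
      unfolding PLC_def w_def using F by blast
  next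
    case False
    then have "\<forall>b\<in>F - {a}. k b = 0"
      using F(4) by force
    then show ?thesis
      unfolding w_def by simp
  qed
  moreover have "v = (if a \<in> F then k a else 0) *\<^sub>R a + w"
    using F(2) by (simp add: F(1) w_def sum.remove)
  ultimately show thesis
    using F(4) by (intro that[of "if a \<in> F then k a else 0" w]) auto
qed

lemma PLC_comb:
  assumes "v \<in> PLC A" "w \<in> PLC A" "x \<ge> 0" "y \<ge> 0" "x > 0 \<or> y > 0"
  shows "x *\<^sub>R v + y *\<^sub>R w \<in> PLC A"
proof (cases "x = 0 \<or> y = 0")
  case True
  then show ?thesis
    using assms PLC_scaleR by auto
next
  case False
  then show ?thesis
    using assms by (intro PLC_add PLC_scaleR) auto
qed

text \<open>Let \<open>c\<close> be the coefficient of \<open>a\<close> in such a combination.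
  Moving \<open>b\<close> to the other side gives \<open>(x - c) *\<^sub>R a = z\<close> with
  \<open>z\<close> in \<open>PLC (A - {a})\<close>. If \<open>x > c\<close>, division contradicts
  the extremality of \<open>a\<close>; otherwise 0 becomes a positive combination.\<close>

lemma mixed_not_PLC:
  assumes "0 \<notin> PLC A" "a \<in> A" "b \<in> A" "a \<noteq> b" "a \<notin> PLC (A - {a})" "x > 0" "y > 0"
  shows "x *\<^sub>R a - y *\<^sub>R b \<notin> PLC A"
proof
  assume "x *\<^sub>R a - y *\<^sub>R b \<in> PLC A"
  then obtain c w where cw: "c \<ge> 0" "x *\<^sub>R a - y *\<^sub>R b = c *\<^sub>R a + w" "w = 0 \<or> w \<in> PLC (A - {a})"
    by (rule PLC_split)
  define z where "z = w + y *\<^sub>R b"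
  have "b \<in> PLC (A - {a})"
    using assms by (intro PLC_base) auto
  then have z: "z \<in> PLC (A - {a})"
    using cw(3) PLC_add PLC_scaleR assms(7) unfolding z_def by fastforce
  have eq: "(x - c) *\<^sub>R a = z"
    using cw(2) by (simp add: z_def algebra_simps)
  show False
  proof (cases "x > c")
    case True
    then have "a = (1 / (x - c)) *\<^sub>R z"
      by (simp flip: eq)
    then show False
      using PLC_scaleR[OF z, of "1 / (x - c)"] True assms(5) by simp
  next
    case False
    have "0 = (c - x) *\<^sub>R a + 1 *\<^sub>R z"
      by (simp flip: eq add: algebra_simps)
    also have "\<dots> \<in> PLC A"
      using False z PLC_mono[of "A - {a}" A] PLC_base[OF assms(2)]
      by (intro PLC_comb) auto
    finally show False
      using assms(1) by simp
  qed
qed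

section \<open>Chebyshev polynomials and alternating words\<close>

text \<open>Chebyshev polynomials of the second kind with the index shifted by one:
  \<open>cheb c n\<close> is the classical U of degree \<open>n - 1\<close> at
  \<open>c\<close>.\<close>

fun cheb :: "real \<Rightarrow> nat \<Rightarrow> real" where
  "cheb c 0 = 0"
| "cheb c (Suc 0) = 1"
| "cheb c (Suc (Suc n)) = 2 * c * cheb c (Suc n) - cheb c n"

lemma cheb_cos:
  assumes "sin \<theta> \<noteq> 0"
  shows "cheb (cos \<theta>) n = sin (of_nat n * \<theta>) / sin \<theta>"
proof (induction "cos \<theta>" n rule: cheb.induct)
  case (3 n)
  have "sin (of_nat (Suc (Suc n)) * \<theta>) + sin (of_nat n * \<theta>) = 2 * cos \<theta> * sin (of_nat (Suc n) * \<theta>)"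
    using sin_add[of "of_nat (Suc n) * \<theta>" \<theta>] sin_diff[of "of_nat (Suc n) * \<theta>" \<theta>]
    by (simp add: algebra_simps)
  then show ?case
    using 3 assms by (simp add: field_simps)
qed (use assms in auto)

text \<open>The increments do not decrease when \<open>c\<close> is at least 1, so carrying an
  increment of at least 1 through the induction also keeps the values nonnegative.\<close>

lemma cheb_ge_1:
  assumes "c \<ge> 1"
  shows "cheb c n \<ge> 0 \<and> cheb c (Suc n) \<ge> cheb c n + 1"
proof (induction n)
  case (Suc n)
  have "2 * c * cheb c (Suc n) \<ge> 2 * cheb c (Suc n)"
    using assms Suc by (simp add: mult_right_mono)
  with Suc show ?case
    unfolding cheb.simps by linarith
qed simp

text \<open>The last letter, which acts first, is \<open>t\<close>. Letters are added on the left,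
  so the first letter depends on the parity of the length.\<close>

primrec alt :: "'s \<Rightarrow> 's \<Rightarrow> nat \<Rightarrow> 's list" where
  "alt s t 0 = []"
| "alt s t (Suc k) = (if even k then t else s) # alt s t k"

lemma length_alt [simp]: "length (alt s t k) = k"
  by (induction k) auto

lemma set_alt: "set (alt s t k) \<subseteq> {s, t}"
  by (induction k) auto

lemma alt_snoc: "alt s t (Suc k) = alt t s k @ [t]"
  by (induction k) auto

lemma alt_append: "\<exists>us. alt s t (j + k) = us @ alt s t k \<and> set us \<subseteq> {s, t} \<and> length us = j"
proof (induction j)
  case (Suc j)
  then obtain us where "alt s t (j + k) = us @ alt s t k" "set us \<subseteq> {s, t}" "length us = j"
    by blast
  then show ?case
    by (intro exI[of _ "(if even (j + k) then t else s) # us"]) auto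
qed simp

lemma alternating_eq_alt:
  assumes "set us \<subseteq> {s, t}" "distinct_adj us" "us \<noteq> [] \<Longrightarrow> last us = t"
  shows "us = alt s t (length us)"
  using assms
proof (induction us)
  case (Cons x us)
  show ?case
  proof (cases us)
    case Nil
    then show ?thesis
      using Cons.prems by simp
  next
    case (Cons y vs)
    then have "us = alt s t (Suc (length vs))"
      using Cons.IH Cons.prems by auto
    then have "y = (if even (length vs) then t else s)" "x \<noteq> y"
      using Cons Cons.prems by auto
    then have "x = (if even (length us) then t else s)"
      using Cons Cons.prems by (auto split: if_splits)
    moreover have "us = alt s t (length us)"
      using \<open>us = alt s t (Suc (length vs))\<close> Cons by (metis length_Cons)
    ultimately show ?thesis
      by (metis alt.simps(2) length_Cons)
  qed
qed simp

lemma not_distinct_adj_split: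
  "\<not> distinct_adj us \<Longrightarrow> \<exists>vs x ws. us = vs @ x # x # ws"
proof (induction us)
  case (Cons x us)
  show ?case
  proof (cases "distinct_adj us")
    case True
    then obtain ws where "us = x # ws"
      using Cons.prems by (cases us) auto
    then show ?thesis
      by (metis append_Nil)
  next
    case False
    then show ?thesis
      using Cons.IH by (metis append_Cons)
  qed
qed simp

section \<open>Root systems from families of reflections\<close>

text \<open>One side of the pairing: \<open>f s\<close> stands for the pairing with the partner of
  \<open>\<alpha> s\<close>. Both root systems are instances.\<close>

locale reflection_family =
  fixes S :: "'s set" and \<alpha> :: "'s \<Rightarrow> 'v::real_vector" and f :: "'s \<Rightarrow> 'v \<Rightarrow> real"
  assumes linear_f: "s \<in> S \<Longrightarrow> linear (f s)"
    and f_self: "s \<in> S \<Longrightarrow> f s (\<alpha> s) = 1"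
    and inj_\<alpha>: "inj_on \<alpha> S"
    and zero_notin: "0 \<notin> PLC (\<alpha> ` S)"
    and extreme: "s \<in> S \<Longrightarrow> \<alpha> s \<notin> PLC (\<alpha> ` S - {\<alpha> s})"
begin

section \<open>Words in the reflections and the group they generate\<close>

definition r :: "'s \<Rightarrow> 'v \<Rightarrow> 'v" where
  "r s x = x - (2 * f s x) *\<^sub>R \<alpha> s"

abbreviation act :: "'s list \<Rightarrow> 'v \<Rightarrow> 'v" where
  "act ws \<equiv> foldr r ws"

lemma act_append: "act (us @ vs) = act us \<circ> act vs"
  by (simp add: fun_eq_iff)

abbreviation W :: "('v \<Rightarrow> 'v) set" where
  "W \<equiv> generate GL (r ` S)"

lemma linear_r: "s \<in> S \<Longrightarrow> linear (r s)"
  unfolding r_def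
  by (rule linearI)
    (simp_all add: linear_add[OF linear_f] linear_scale[OF linear_f] algebra_simps)

lemma r_self: "s \<in> S \<Longrightarrow> r s (\<alpha> s) = - \<alpha> s"
  by (simp add: r_def f_self scaleR_2)

lemma r_r [simp]: "s \<in> S \<Longrightarrow> r s (r s x) = x"
  by (simp add: r_def linear_diff[OF linear_f] linear_scale[OF linear_f] f_self)

lemma r_in_GL: "s \<in> S \<Longrightarrow> r s \<in> carrier GL"
  using linear_r[of s] by (auto simp: GL_def fun_eq_iff intro!: o_bij[of "r s" "r s"])

lemma linear_act: "set ws \<subseteq> S \<Longrightarrow> linear (act ws)"
proof (induction ws)
  case (Cons s ws)
  then show ?case
    using linear_compose[of "act ws" "r s"] linear_r[of s] by (simp add: o_def)
qed (simp add: linear_id flip: id_def)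

text \<open>The generators are involutions, so inverses contribute no new letters.\<close>

lemma W_eq: "W = {act ws | ws. set ws \<subseteq> S}"
proof (intro equalityI subsetI)
  fix w assume "w \<in> W"
  then show "w \<in> {act ws | ws. set ws \<subseteq> S}"
  proof induction
    case one
    show ?case
      by (intro CollectI exI[of _ "[]"]) (simp add: GL_def)
  next
    case (incl h)
    then obtain s where "s \<in> S" "h = r s" by blast
    then show ?case
      by (intro CollectI exI[of _ "[s]"]) auto
  next
    case (inv h)
    then obtain s where s: "s \<in> S" "h = r s" by blast
    interpret group "GL :: ('v \<Rightarrow> 'v) monoid"
      by (rule group_GL)
    have "r s \<otimes>\<^bsub>GL\<^esub> r s = \<one>\<^bsub>GL\<^esub>"
      using s by (simp add: GL_def fun_eq_iff)
    then have "inv\<^bsub>GL\<^esub> r s = r s"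
      using r_in_GL[OF s(1)] by (intro inv_equality) auto
    then show ?case
      using s by (intro CollectI exI[of _ "[s]"]) auto
  next
    case (eng g h)
    then obtain us vs where "set us \<subseteq> S" "set vs \<subseteq> S" "g = act us" "h = act vs"
      by blast
    then show ?case
      by (intro CollectI exI[of _ "us @ vs"]) (simp add: GL_def)
  qed
next
  fix w assume "w \<in> {act ws | ws. set ws \<subseteq> S}"
  then obtain ws where "w = act ws" "set ws \<subseteq> S"
    by blast
  moreover have "set ws \<subseteq> S \<Longrightarrow> act ws \<in> W"
  proof (induction ws)
    case Nil
    show ?case
      using generate.one[of GL "r ` S"] by (simp add: GL_def id_def)
  next
    case (Cons s ws)
    then show ?case
      using generate.eng[OF generate.incl[of "r s" "r ` S"], of "act ws" GL] by (simp add: GL_def o_def)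
  qed
  ultimately show "w \<in> W"
    by simp
qed

section \<open>Signs of roots\<close>

abbreviation \<Phi> :: "'v set" where
  "\<Phi> \<equiv> root_system W (\<alpha> ` S)"

lemma root_system_eq: "\<Phi> = {act ws (\<alpha> s) | ws s. set ws \<subseteq> S \<and> s \<in> S}"
  unfolding root_system_def W_eq by blast

lemma uminus_root:
  assumes "z \<in> \<Phi>"
  shows "- z \<in> \<Phi>"
proof -
  obtain ws s where z: "z = act ws (\<alpha> s)" "set ws \<subseteq> S" "s \<in> S"
    using assms unfolding root_system_eq by blast
  have "- z = act (ws @ [s]) (\<alpha> s)"
    using z by (simp add: r_self linear_neg[OF linear_act])
  then show ?thesis
    using z unfolding root_system_eq by (intro CollectI exI[of _ "ws @ [s]"] exI[of _ s]) auto
qed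

text \<open>The roots are closed under negation, which gives the union. Disjointness is automatic:
  if a vector and its negative were both positive, their sum 0 would lie in
  \<open>PLC\<close>.\<close>

lemma decomposition_iff:
  "\<Phi> = pos_roots W (\<alpha> ` S) \<union> neg_roots W (\<alpha> ` S) \<and>
     pos_roots W (\<alpha> ` S) \<inter> neg_roots W (\<alpha> ` S) = {} \<longleftrightarrow>
   (\<forall>z\<in>\<Phi>. z \<in> PLC (\<alpha> ` S) \<or> - z \<in> PLC (\<alpha> ` S))" (is "?L \<longleftrightarrow> ?R")
proof
  assume L: ?L
  have "pos_roots W (\<alpha> ` S) \<subseteq> PLC (\<alpha> ` S)" "uminus ` neg_roots W (\<alpha> ` S) \<subseteq> PLC (\<alpha> ` S)"
    by (auto simp: pos_roots_def neg_roots_def)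
  with L show ?R
    by blast
next
  assume R: ?R
  have "z \<in> pos_roots W (\<alpha> ` S) \<union> neg_roots W (\<alpha> ` S)" if "z \<in> \<Phi>" for z
    using R that uminus_root[OF that] unfolding pos_roots_def neg_roots_def
    by (metis IntI UnI1 UnI2 image_eqI minus_minus)
  moreover have "neg_roots W (\<alpha> ` S) \<subseteq> \<Phi>"
    using uminus_root by (auto simp: pos_roots_def neg_roots_def)
  moreover have "pos_roots W (\<alpha> ` S) \<inter> neg_roots W (\<alpha> ` S) = {}"
  proof (rule ccontr)
    assume "\<not> ?thesis"
    then obtain z where "- z \<in> PLC (\<alpha> ` S)" "z \<in> PLC (\<alpha> ` S)"
      by (auto simp: pos_roots_def neg_roots_def)
    then show False
      using PLC_add zero_notin by fastforce
  qed
  ultimately show ?L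
    by (auto simp: pos_roots_def)
qed

section \<open>Combinations of two simple roots and the braid relation\<close>

lemma mixed_not_signed:
  assumes "s \<in> S" "t \<in> S" "s \<noteq> t" "x * y < 0"
  shows "x *\<^sub>R \<alpha> s + y *\<^sub>R \<alpha> t \<notin> PLC (\<alpha> ` S)" "- (x *\<^sub>R \<alpha> s + y *\<^sub>R \<alpha> t) \<notin> PLC (\<alpha> ` S)"
proof -
  have ne: "\<alpha> s \<noteq> \<alpha> t"
    using assms inj_\<alpha> by (auto simp: inj_on_def)
  have st: "p *\<^sub>R \<alpha> s - q *\<^sub>R \<alpha> t \<notin> PLC (\<alpha> ` S)" if "p > 0" "q > 0" for p q
    using assms ne that extreme zero_notin by (intro mixed_not_PLC) auto
  have ts: "p *\<^sub>R \<alpha> t - q *\<^sub>R \<alpha> s \<notin> PLC (\<alpha> ` S)" if "p > 0" "q > 0" for p q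
    using assms ne that extreme zero_notin by (intro mixed_not_PLC) auto
  have eq: "x *\<^sub>R \<alpha> s + y *\<^sub>R \<alpha> t = x *\<^sub>R \<alpha> s - (- y) *\<^sub>R \<alpha> t"
    "x *\<^sub>R \<alpha> s + y *\<^sub>R \<alpha> t = y *\<^sub>R \<alpha> t - (- x) *\<^sub>R \<alpha> s"
    "- (x *\<^sub>R \<alpha> s + y *\<^sub>R \<alpha> t) = (- y) *\<^sub>R \<alpha> t - x *\<^sub>R \<alpha> s"
    "- (x *\<^sub>R \<alpha> s + y *\<^sub>R \<alpha> t) = (- x) *\<^sub>R \<alpha> s - y *\<^sub>R \<alpha> t"
    by simp_all
  have sgn: "x > 0 \<and> - y > 0 \<or> - x > 0 \<and> y > 0"
    using assms(4) by (auto simp: mult_less_0_iff)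
  show "x *\<^sub>R \<alpha> s + y *\<^sub>R \<alpha> t \<notin> PLC (\<alpha> ` S)"
    using sgn st[of x "- y"] ts[of y "- x"] eq(1,2) by metis
  show "- (x *\<^sub>R \<alpha> s + y *\<^sub>R \<alpha> t) \<notin> PLC (\<alpha> ` S)"
    using sgn ts[of "- y" x] st[of "- x" y] eq(3,4) by metis
qed

text \<open>Rescaling \<open>\<alpha> t\<close> by \<open>k\<close> and \<open>f t\<close> by \<open>1 / k\<close> leaves \<open>r t\<close> unchanged and makes the rank two
  pairing symmetric with off-diagonal entry \<open>- c\<close>.\<close>

lemma act_alt:
  assumes "s \<in> S" "t \<in> S" "k > 0" "f t (\<alpha> s) = - c * k" "f s (\<alpha> t) = - c / k"
  shows "act (alt s t n) (\<alpha> s) =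
    (if even n then cheb c (Suc n) *\<^sub>R \<alpha> s + (k * cheb c n) *\<^sub>R \<alpha> t
     else cheb c n *\<^sub>R \<alpha> s + (k * cheb c (Suc n)) *\<^sub>R \<alpha> t)"
proof (induction n)
  case (Suc n)
  \<comment> \<open>Each reflection changes a single coordinate, and the new coordinate is the next
    term of the recurrence for \<open>cheb\<close>.\<close>
  have rt: "r t (x *\<^sub>R \<alpha> s + y *\<^sub>R \<alpha> t) = x *\<^sub>R \<alpha> s + (2 * c * k * x - y) *\<^sub>R \<alpha> t" for x y
    using assms f_self[of t]
    by (simp add: r_def linear_add[OF linear_f] linear_scale[OF linear_f] algebra_simps flip: scaleR_add_left)
  have rs: "r s (x *\<^sub>R \<alpha> s + y *\<^sub>R \<alpha> t) = (2 * c / k * y - x) *\<^sub>R \<alpha> s + y *\<^sub>R \<alpha> t" for x y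
    using assms f_self[of s]
    by (simp add: r_def linear_add[OF linear_f] linear_scale[OF linear_f] algebra_simps flip: scaleR_add_left)
  show ?case
    using Suc rt rs assms(3) by (simp add: algebra_simps)
qed simp

text \<open>Both words agree on \<open>\<alpha> s\<close> and \<open>\<alpha> t\<close> by the
  Chebyshev values near \<open>m\<close>. Since the rank two pairing has determinant
  \<open>1 - c\<^sup>2 > 0\<close>, every vector is a combination of these two plus a vector killed
  by \<open>f s\<close> and \<open>f t\<close>, which all words in \<open>s\<close> and
  \<open>t\<close> fix.\<close>

lemma braid_relation:
  fixes m :: nat
  assumes st: "s \<in> S" "t \<in> S" and k: "k > 0" "f t (\<alpha> s) = - c * k" "f s (\<alpha> t) = - c / k"
    and m: "m \<ge> 2" "c = cos (pi / m)"
  shows "act (alt s t m) = act (alt t s m)"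
proof
  fix x
  define \<theta> where "\<theta> = pi / m"
  have \<theta>: "0 < \<theta>" "\<theta> < pi" "m * \<theta> = pi"
    using m pi_gt_zero by (auto simp: \<theta>_def field_simps)
  have s0: "sin \<theta> > 0"
    using \<theta> by (intro sin_gt_zero) auto
  have c: "c = cos \<theta>"
    using m by (simp add: \<theta>_def)
  obtain j where j: "m = Suc j"
    using m by (cases m) auto
  have "j * \<theta> = pi - \<theta>" "Suc m * \<theta> = pi + \<theta>"
    using \<theta>(3) by (simp_all add: j algebra_simps)
  then have u: "cheb c m = 0" "cheb c (Suc m) = - 1" "cheb c j = 1"
    using s0 \<theta>(3) by (simp_all add: c cheb_cos del: of_nat_Suc)
  \<comment> \<open>Exchanging \<open>s\<close> and \<open>t\<close> replaces \<open>k\<close> by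
    its inverse.\<close>
  have k': "1 / k > 0" "f s (\<alpha> t) = - c * (1 / k)" "f t (\<alpha> s) = - c / (1 / k)"
    using k by auto
  note a = act_alt[OF st k] act_alt[OF st(2,1) k']
  have lin: "linear (act (alt s t n))" "linear (act (alt t s n))" for n
    using set_alt[of s t n] set_alt[of t s n] st by (auto intro!: linear_act)
  \<comment> \<open>The second word ends in \<open>s\<close>, which negates
    \<open>\<alpha> s\<close>; what remains is an alternating word of length \<open>m - 1\<close>
    ending in \<open>t\<close>, so \<open>act_alt\<close> covers both sides.\<close>
  have on_s: "act (alt s t m) (\<alpha> s) = act (alt t s m) (\<alpha> s)"
    using u k(1) by (simp add: a(1) del: alt.simps)
      (simp add: j alt_snoc r_self st linear_neg[OF lin(1)] a(1) del: alt.simps)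
  have on_t: "act (alt s t m) (\<alpha> t) = act (alt t s m) (\<alpha> t)"
    using u k(1) by (simp add: a(2) del: alt.simps)
      (simp add: j alt_snoc r_self st linear_neg[OF lin(2)] a(2) del: alt.simps)
  have "c\<^sup>2 < 1"
    using sin_cos_squared_add[of \<theta>] zero_less_power[OF s0, of 2] unfolding c by linarith
  \<comment> \<open>Cramer's rule for the coefficients that make \<open>f s x'\<close> and
    \<open>f t x'\<close> vanish.\<close>
  define p where "p = (f s x + c / k * f t x) / (1 - c\<^sup>2)"
  define q where "q = (f t x + c * k * f s x) / (1 - c\<^sup>2)"
  define x' where "x' = x - (p *\<^sub>R \<alpha> s + q *\<^sub>R \<alpha> t)"
  have "f s x = p - q * (c / k)" "f t x = q - p * (c * k)"
    using \<open>c\<^sup>2 < 1\<close> k(1) unfolding p_def q_def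
    by (simp_all add: divide_simps) (simp_all add: algebra_simps power2_eq_square)
  then have "f s x' = 0" "f t x' = 0"
    using f_self st k
    by (simp_all add: x'_def linear_diff[OF linear_f] linear_add[OF linear_f] linear_scale[OF linear_f])
  then have "act ws x' = x'" if "set ws \<subseteq> {s, t}" for ws
    using that by (induction ws) (auto simp: r_def)
  then have "act (alt s t m) x' = act (alt t s m) x'"
    using set_alt by (metis insert_commute)
  moreover have "x = x' + (p *\<^sub>R \<alpha> s + q *\<^sub>R \<alpha> t)"
    by (simp add: x'_def)
  ultimately show "act (alt s t m) x = act (alt t s m) x"
    using on_s on_t by (simp add: linear_add[OF lin(1)] linear_add[OF lin(2)]
        linear_scale[OF lin(1)] linear_scale[OF lin(2)])
qed

section \<open>The condition on the pairing and its necessity\<close>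

definition coxeter_condition :: bool where
  "coxeter_condition \<longleftrightarrow> (\<forall>s\<in>S. \<forall>t\<in>S.
     (s \<noteq> t \<longrightarrow> f t (\<alpha> s) \<le> 0 \<and> f s (\<alpha> t) \<le> 0) \<and>
     (f t (\<alpha> s) = 0 \<longleftrightarrow> f s (\<alpha> t) = 0) \<and>
     ((\<exists>m::int. m \<ge> 2 \<and> f t (\<alpha> s) * f s (\<alpha> t) = (cos (pi / of_int m))\<^sup>2) \<or>
      f t (\<alpha> s) * f s (\<alpha> t) \<ge> 1))"

text \<open>Supplies the parameters of \<open>act_alt\<close>: \<open>c\<close> is the geometric
  mean of \<open>- a\<close> and \<open>- b\<close>, and \<open>k\<close> is the scaling that makes
  them equal. If both vanish, \<open>k = 1\<close> is chosen.\<close>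

lemma symmetric_scaling:
  assumes "a \<le> 0" "b \<le> 0" "a = 0 \<longleftrightarrow> b = 0"
  obtains c k :: real where "k > 0" "c \<ge> 0" "a = - c * k" "b = - c / k" "a * b = c\<^sup>2"
proof (cases "a = 0")
  case True
  then show thesis
    using assms by (intro that[of 1 0]) auto
next
  case False
  then have n: "- a > 0" "- b > 0"
    using assms by auto
  define c where "c = sqrt (a * b)"
  have ab: "a * b > 0"
    using n by (simp add: mult_neg_neg)
  then have "c > 0" "c\<^sup>2 = a * b"
    by (simp_all add: c_def)
  moreover from this have "b = - c / (- a / c)"
    using n by (simp add: field_simps power2_eq_square)
  ultimately show thesis
    using n by (intro that[of "- a / c" c]) (auto simp: divide_neg_pos)
qed

text \<open>The violation of each clause for distinct \<open>s\<close> and \<open>t\<close> produces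
  a root with coefficients of opposite sign: a word of length one or two for the first two clauses,
  an alternating word for the third.\<close>

lemma signed_imp_coxeter_condition:
  assumes signed: "\<And>z. z \<in> \<Phi> \<Longrightarrow> z \<in> PLC (\<alpha> ` S) \<or> - z \<in> PLC (\<alpha> ` S)"
  shows coxeter_condition
proof -
  have no_mixed: "x * y \<ge> 0"
    if "s \<in> S" "t \<in> S" "s \<noteq> t" "set ws \<subseteq> S" "act ws (\<alpha> u) = x *\<^sub>R \<alpha> s + y *\<^sub>R \<alpha> t" "u \<in> S"
    for s t u ws x y
  proof (rule ccontr)
    assume "\<not> x * y \<ge> 0"
    then have "x * y < 0"
      by simp
    moreover have "x *\<^sub>R \<alpha> s + y *\<^sub>R \<alpha> t \<in> \<Phi>"
      unfolding root_system_eq using that by force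
    ultimately show False
      using signed mixed_not_signed[OF that(1-3)] by blast
  qed
  have neg: "f t (\<alpha> s) \<le> 0" if "s \<in> S" "t \<in> S" "s \<noteq> t" for s t
  proof -
    have "act [t] (\<alpha> s) = 1 *\<^sub>R \<alpha> s + (- 2 * f t (\<alpha> s)) *\<^sub>R \<alpha> t"
      by (simp add: r_def)
    then show ?thesis
      using no_mixed[OF that, of "[t]" s] that by fastforce
  qed
  have zero: "f s (\<alpha> t) = 0" if "s \<in> S" "t \<in> S" "s \<noteq> t" "f t (\<alpha> s) = 0" for s t
  proof -
    have "act [t, s] (\<alpha> t) = (- 2 * f s (\<alpha> t)) *\<^sub>R \<alpha> s + (- 1) *\<^sub>R \<alpha> t"
      using that by (simp add: r_def linear_diff[OF linear_f] linear_scale[OF linear_f] f_self algebra_simps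
          flip: scaleR_2)
    then have "f s (\<alpha> t) \<ge> 0"
      using no_mixed[OF that(1-3), of "[t, s]" t] that by fastforce
    then show ?thesis
      using neg[of t s] that by simp
  qed
  have cos: "\<exists>m::int. m \<ge> 2 \<and> f t (\<alpha> s) * f s (\<alpha> t) = (cos (pi / of_int m))\<^sup>2"
    if st: "s \<in> S" "t \<in> S" "s \<noteq> t" and lt: "f t (\<alpha> s) * f s (\<alpha> t) < 1" for s t
  proof -
    have "f t (\<alpha> s) = 0 \<longleftrightarrow> f s (\<alpha> t) = 0"
      using zero st by metis
    then obtain c k where k: "k > 0" "c \<ge> 0" "f t (\<alpha> s) = - c * k" "f s (\<alpha> t) = - c / k"
        and c2: "f t (\<alpha> s) * f s (\<alpha> t) = c\<^sup>2"
      using symmetric_scaling[of "f t (\<alpha> s)" "f s (\<alpha> t)"] neg st by metis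
    have "c < 1"
      using lt k(2) by (simp add: c2 power_less_one_iff)
    define \<theta> where "\<theta> = arccos c"
    have \<theta>: "0 < \<theta>" "\<theta> \<le> pi / 2" "cos \<theta> = c"
      using \<open>c < 1\<close> k(2) arccos_lt_bounded[of c] arccos_le_pi2[of c] by (auto simp: \<theta>_def)
    have s0: "sin \<theta> > 0"
      using \<theta> by (intro sin_gt_zero) auto
    \<comment> \<open>\<open>m\<close> is the first index at which the multiples of \<theta> reach
      \<pi>; the aim is to show that \<pi> is hit exactly.\<close>
    define m where "m = (LEAST n::nat. n * \<theta> \<ge> pi)"
    obtain n0 :: nat where "n0 * \<theta> \<ge> pi"
      using reals_Archimedean3[OF \<theta>(1)] by (metis less_imp_le)
    then have m: "m * \<theta> \<ge> pi"
      unfolding m_def by (rule LeastI)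
    have "m \<ge> 2"
    proof (rule ccontr)
      assume "\<not> m \<ge> 2"
      then have "m * \<theta> \<le> 1 * \<theta>"
        using \<theta>(1) by (intro mult_right_mono) auto
      then show False
        using m \<theta>(2) pi_gt_zero by linarith
    qed
    then obtain j where j: "m = Suc j" "j \<ge> 1"
      by (cases m) auto
    have "\<not> j * \<theta> \<ge> pi"
      using not_less_Least[of j "\<lambda>n. real n * \<theta> \<ge> pi"] j by (simp add: m_def)
    then have "sin (j * \<theta>) > 0"
      using j \<theta>(1) by (intro sin_gt_zero) auto
    then have uj: "cheb c j > 0"
      using s0 by (simp add: cheb_cos flip: \<theta>(3))
    have "m * \<theta> = pi"
    proof (rule ccontr)
      \<comment> \<open>An overshoot is less than \<theta>, so the sine is negative at
        \<open>m\<close> and positive at \<open>j = m - 1\<close>. The word \<open>alt s t j\<close>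
        applied to \<open>\<alpha> s\<close> has both Chebyshev values as coefficients, up to the
        positive factor \<open>k\<close>.\<close>
      assume "m * \<theta> \<noteq> pi"
      then have "sin (m * \<theta>) < 0"
        using m \<open>\<not> j * \<theta> \<ge> pi\<close> \<theta> j by (intro sin_lt_zero) (auto simp: algebra_simps)
      then have "cheb c (Suc j) < 0"
        using s0 by (simp add: cheb_cos divide_neg_pos j(1) flip: \<theta>(3) del: of_nat_Suc)
      then have "cheb c j * (k * cheb c (Suc j)) < 0" "cheb c (Suc j) * (k * cheb c j) < 0"
        using uj k(1) by (auto intro: mult_pos_neg mult_neg_pos)
      moreover have "set (alt s t j) \<subseteq> S"
        using set_alt[of s t j] st by auto
      ultimately show False
        using no_mixed[OF st, of "alt s t j" s] act_alt[OF st(1,2) k(1,3,4), of j] st(1)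
        by (cases "even j") fastforce+
    qed
    then have "\<theta> = pi / of_int (int m)"
      using \<open>m \<ge> 2\<close> by (simp add: field_simps)
    then show ?thesis
      using \<theta>(3) c2 \<open>m \<ge> 2\<close> by (intro exI[of _ "int m"]) auto
  qed
  show ?thesis
    unfolding coxeter_condition_def
  proof (intro ballI)
    fix s t assume st: "s \<in> S" "t \<in> S"
    show "(s \<noteq> t \<longrightarrow> f t (\<alpha> s) \<le> 0 \<and> f s (\<alpha> t) \<le> 0) \<and>
     (f t (\<alpha> s) = 0 \<longleftrightarrow> f s (\<alpha> t) = 0) \<and>
     ((\<exists>m::int. m \<ge> 2 \<and> f t (\<alpha> s) * f s (\<alpha> t) = (cos (pi / of_int m))\<^sup>2) \<or>
      f t (\<alpha> s) * f s (\<alpha> t) \<ge> 1)"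
    proof (cases "s = t")
      case True
      then show ?thesis
        using st f_self by simp
    next
      case False
      then show ?thesis
        using st neg[of s t] neg[of t s] zero[of s t] zero[of t s] cos[of s t] by fastforce
    qed
  qed
qed

section \<open>Sufficiency: positivity along reduced words\<close>

text \<open>If \<open>us\<close> were at least as long as the braid relation of \<open>s\<close> and \<open>t\<close>, this relation would turn
  it into a word of the same length that ends with \<open>s\<close>, against the last assumption.\<close>

lemma alternating_positive:
  assumes cox: coxeter_condition and st: "s \<in> S" "t \<in> S" "s \<noteq> t"
    and us: "set us \<subseteq> {s, t}" "distinct_adj us"
    and no_s: "\<And>vs. set vs \<subseteq> {s, t} \<Longrightarrow> length vs < length us \<Longrightarrow> act (vs @ [s]) \<noteq> act us"
  obtains x y where "x \<ge> 0" "y \<ge> 0" "x > 0 \<or> y > 0" "act us (\<alpha> s) = x *\<^sub>R \<alpha> s + y *\<^sub>R \<alpha> t"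
proof -
  \<comment> \<open>A word ending in \<open>s\<close> is excluded by \<open>no_s\<close>, applied to
    the word without its last letter.\<close>
  have "last us = t" if "us \<noteq> []"
  proof (rule ccontr)
    assume "last us \<noteq> t"
    moreover have "last us \<in> {s, t}"
      using us that last_in_set by blast
    ultimately have "us = butlast us @ [s]"
      using that by (metis append_butlast_last_id insertE singletonD)
    then show False
      using no_s[of "butlast us"] us that by (metis in_set_butlastD length_butlast
          diff_less length_greater_0_conv subset_iff zero_less_one)
  qed
  then have alt: "us = alt s t (length us)"
    using us alternating_eq_alt by metis
  define n where "n = length us"
  have cc: "f t (\<alpha> s) \<le> 0" "f s (\<alpha> t) \<le> 0" "f t (\<alpha> s) = 0 \<longleftrightarrow> f s (\<alpha> t) = 0"
    "(\<exists>m::int. m \<ge> 2 \<and> f t (\<alpha> s) * f s (\<alpha> t) = (cos (pi / of_int m))\<^sup>2) \<or> f t (\<alpha> s) * f s (\<alpha> t) \<ge> 1"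
    using cox st unfolding coxeter_condition_def by metis+
  obtain c k where k: "k > 0" "c \<ge> 0" "f t (\<alpha> s) = - c * k" "f s (\<alpha> t) = - c / k"
      and c2: "f t (\<alpha> s) * f s (\<alpha> t) = c\<^sup>2"
    using symmetric_scaling[OF cc(1-3)] by metis
  have pos: "cheb c n \<ge> 0 \<and> cheb c (Suc n) \<ge> 0 \<and> (cheb c n > 0 \<or> cheb c (Suc n) > 0)"
    using cc(4)
  proof
    assume "f t (\<alpha> s) * f s (\<alpha> t) \<ge> 1"
    then have "c \<ge> 1"
      using k(2) c2 by (metis linorder_not_le power_less_one_iff zero_less_numeral)
    then show ?thesis
      using cheb_ge_1[of c n] by auto
  next
    assume "\<exists>m::int. m \<ge> 2 \<and> f t (\<alpha> s) * f s (\<alpha> t) = (cos (pi / of_int m))\<^sup>2"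
    then obtain m' :: int where m': "m' \<ge> 2" "c\<^sup>2 = (cos (pi / of_int m'))\<^sup>2"
      using c2 by auto
    define m where "m = nat m'"
    define \<theta> where "\<theta> = pi / m"
    have m: "m \<ge> 2" "real_of_int m' = real m"
      using m' by (auto simp: m_def)
    have \<theta>: "0 < \<theta>" "\<theta> \<le> pi / 2" "m * \<theta> = pi"
      using m(1) pi_gt_zero by (auto simp: \<theta>_def field_simps)
    \<comment> \<open>Only the squares are known to agree; nonnegativity on both sides removes the
      ambiguity of sign.\<close>
    have "cos \<theta> \<ge> 0"
      using \<theta> by (intro cos_ge_zero) auto
    then have c: "c = cos \<theta>"
      using m' m k(2) by (simp add: \<theta>_def power2_eq_iff_nonneg)
    have s0: "sin \<theta> > 0"
      using \<theta> by (intro sin_gt_zero) auto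
    have "n < m"
    proof (rule ccontr)
      assume "\<not> n < m"
      then obtain j where j: "n = j + m"
        by (metis add.commute le_Suc_ex not_less)
      obtain i where i: "m = Suc i"
        using m(1) by (cases m) auto
      obtain vs where vs: "us = vs @ alt s t m" "set vs \<subseteq> {s, t}" "length vs = j"
        using alt_append[of s t j m] alt by (metis n_def j)
      have "act us = act (vs @ alt t s m)"
        using braid_relation[OF st(1,2) k(1,3,4) m(1)] c vs(1) by (simp only: act_append \<theta>_def)
      also have "\<dots> = act ((vs @ alt s t i) @ [s])"
        by (simp add: i alt_snoc del: alt.simps)
      finally show False
        using no_s[of "vs @ alt s t i"] vs set_alt[of s t i] i j by (auto simp: n_def)
    qed
    then have "Suc n * \<theta> \<le> m * \<theta>"
      using \<theta>(1) by (intro mult_right_mono) auto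
    \<comment> \<open>At \<open>Suc n = m\<close> the second sine vanishes, so strict positivity
      comes from the first one; for \<open>n = 0\<close> it comes from \<open>cheb c 1 = 1\<close>
      instead.\<close>
    then have "Suc n * \<theta> \<le> pi" "n * \<theta> < pi"
      using \<theta> by (auto simp: algebra_simps)
    then have "sin (Suc n * \<theta>) \<ge> 0" "sin (n * \<theta>) \<ge> 0" "n > 0 \<Longrightarrow> sin (n * \<theta>) > 0"
      using \<theta>(1) by (auto intro!: sin_ge_zero sin_gt_zero simp del: of_nat_Suc)
    then show ?thesis
      using s0 by (cases "n = 0") (simp, simp add: c cheb_cos del: cheb.simps of_nat_Suc)
  qed
  have "act us (\<alpha> s) =
    (if even n then cheb c (Suc n) *\<^sub>R \<alpha> s + (k * cheb c n) *\<^sub>R \<alpha> t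
     else cheb c n *\<^sub>R \<alpha> s + (k * cheb c (Suc n)) *\<^sub>R \<alpha> t)"
    using act_alt[OF st(1,2) k(1,3,4)] alt by (metis n_def)
  then show thesis
    using pos k(1) that[of "cheb c (Suc n)" "k * cheb c n"] that[of "cheb c n" "k * cheb c (Suc n)"]
    by (cases "even n") auto
qed

definition reduced :: "'s list \<Rightarrow> bool" where
  "reduced ws \<longleftrightarrow> (\<forall>vs. set vs \<subseteq> S \<longrightarrow> act vs = act ws \<longrightarrow> length ws \<le> length vs)"

lemma reduced_exists:
  assumes "set ws \<subseteq> S"
  obtains vs where "set vs \<subseteq> S" "act vs = act ws" "reduced vs" "length vs \<le> length ws"
proof -
  define P where "P vs \<longleftrightarrow> set vs \<subseteq> S \<and> act vs = act ws" for vs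
  have "P ws"
    using assms by (simp add: P_def)
  then obtain vs where vs: "P vs" "\<And>us. P us \<Longrightarrow> length vs \<le> length us"
    using ex_has_least_nat[of P ws length] by metis
  show thesis
    using vs \<open>P ws\<close> by (intro that[of vs]) (auto simp: P_def reduced_def)
qed

text \<open>Split \<open>ws\<close> in the group as \<open>vs @ us\<close> without changing the length, where \<open>us\<close> is a word in
  \<open>s\<close> and the last letter \<open>t\<close> of \<open>ws\<close>, and \<open>vs\<close> is as short as possible. Then the induction
  hypothesis applies to \<open>vs\<close> with both \<open>s\<close> and \<open>t\<close>.\<close>

lemma reduced_positive:
  assumes cox: coxeter_condition
    and "set ws \<subseteq> S" "reduced ws" "s \<in> S"
    and "\<And>vs. set vs \<subseteq> S \<Longrightarrow> act vs = act (ws @ [s]) \<Longrightarrow> length ws \<le> length vs"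
  shows "act ws (\<alpha> s) \<in> PLC (\<alpha> ` S)"
  using assms(2-)
proof (induction "length ws" arbitrary: ws s rule: less_induct)
  case less
  show ?case
  proof (cases ws rule: rev_cases)
    case Nil
    then show ?thesis
      using less.prems by (simp add: PLC_base)
  next
    case (snoc ws' t)
    have t: "t \<in> S" "set ws' \<subseteq> S"
      using less.prems snoc by auto
    have cancel: "act (xs @ p # p # ys) = act (xs @ ys)" if "p \<in> S" for xs p ys
      using that by (simp add: fun_eq_iff)
    have act_app: "act (xs @ ys) = act (xs' @ ys')" if "act xs = act xs'" "act ys = act ys'" for xs ys xs' ys'
      using that by (simp only: act_append)
    have "s \<noteq> t"
    proof
      assume "s = t"
      then show False
        using less.prems(4)[of ws'] cancel[OF t(1), of ws' "[]"] t snoc by simp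
    qed
    define P where "P vs \<longleftrightarrow> set vs \<subseteq> S \<and> (\<exists>us. set us \<subseteq> {s, t} \<and> act (vs @ us) = act ws \<and>
      length (vs @ us) = length ws)" for vs
    \<comment> \<open>This candidate, with \<open>us = [t]\<close>, shows that a shortest
      \<open>vs\<close> is strictly shorter than \<open>ws\<close>, as the induction
      requires.\<close>
    have "P ws'"
      unfolding P_def using t snoc by (intro conjI exI[of _ "[t]"]) auto
    then obtain vs where vs: "P vs" "\<And>xs. P xs \<Longrightarrow> length vs \<le> length xs"
      using ex_has_least_nat[of P ws' length] by metis
    then obtain us where us: "set us \<subseteq> {s, t}" "act (vs @ us) = act ws"
        "length (vs @ us) = length ws" and vsS: "set vs \<subseteq> S"
      unfolding P_def by auto
    have usS: "set us \<subseteq> S"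
      using us(1) t less.prems(3) by auto
    have lt: "length vs < length ws"
      using vs(2)[OF \<open>P ws'\<close>] snoc by simp
    have min: "length ws \<le> length xs" if "set xs \<subseteq> S" "act xs = act ws" for xs
      using less.prems(2) that by (simp add: reduced_def)
    have red: "reduced vs"
      unfolding reduced_def
    proof (intro allI impI)
      fix xs assume "set xs \<subseteq> S" "act xs = act vs"
      then show "length vs \<le> length xs"
        using min[of "xs @ us"] act_app[of xs vs us us] us usS by simp
    qed
    have vp: "act vs (\<alpha> p) \<in> PLC (\<alpha> ` S)" if p: "p \<in> {s, t}" for p
    proof (rule less.hyps[OF lt vsS red])
      show pS: "p \<in> S"
        using p t less.prems(3) by auto
      fix xs assume xs: "set xs \<subseteq> S" "act xs = act (vs @ [p])"
      show "length vs \<le> length xs"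
      proof (rule ccontr)
        \<comment> \<open>Moving \<open>p\<close> to the front of \<open>us\<close> would make
          \<open>xs\<close> a candidate for the splitting that is shorter than \<open>vs\<close>;
          the total length cannot drop because \<open>ws\<close> is reduced.\<close>
        assume sh: "\<not> length vs \<le> length xs"
        have "act (xs @ p # us) = act ((vs @ [p]) @ p # us)"
          using xs(2) by (intro act_app) auto
        also have "\<dots> = act ws"
          using cancel[OF pS, of vs us] us(2) by simp
        finally have e: "act (xs @ p # us) = act ws" .
        have "length ws \<le> length (xs @ p # us)"
          using e xs(1) pS usS by (intro min) auto
        then have "length (xs @ p # us) = length ws"
          using us(3) sh by simp
        then have "P xs"
          unfolding P_def using e xs(1) us(1) p by (intro conjI exI[of _ "p # us"]) auto
        then show False
          using vs(2) sh by blast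
      qed
    qed
    have "distinct_adj us"
    proof (rule ccontr)
      assume "\<not> distinct_adj us"
      then obtain as p bs where u: "us = as @ p # p # bs"
        using not_distinct_adj_split by blast
      then have "act (vs @ as @ bs) = act ws"
        using us(2) usS cancel[of p "vs @ as" bs] by simp
      then show False
        using min[of "vs @ as @ bs"] u usS vsS us(3) by simp
    qed
    \<comment> \<open>Otherwise \<open>vs @ xs\<close> would represent \<open>ws @ [s]\<close> by a
      word shorter than \<open>ws\<close>.\<close>
    moreover have "act (xs @ [s]) \<noteq> act us" if "set xs \<subseteq> {s, t}" "length xs < length us" for xs
    proof
      assume "act (xs @ [s]) = act us"
      then have "act ((vs @ xs @ [s]) @ [s]) = act (ws @ [s])"
        using us(2) by (intro act_app) (simp_all only: act_append)
      then have "act (vs @ xs) = act (ws @ [s])"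
        using cancel[OF less.prems(3), of "vs @ xs" "[]"] by simp
      then show False
        using less.prems(4)[of "vs @ xs"] that us(3) vsS t less.prems(3) by auto
    qed
    ultimately obtain x y where xy: "x \<ge> 0" "y \<ge> 0" "x > 0 \<or> y > 0"
        "act us (\<alpha> s) = x *\<^sub>R \<alpha> s + y *\<^sub>R \<alpha> t"
      using alternating_positive[OF cox less.prems(3) t(1) \<open>s \<noteq> t\<close> us(1)] by metis
    have "act ws (\<alpha> s) = act vs (act us (\<alpha> s))"
      using us(2) by (simp flip: us(2))
    also have "\<dots> = x *\<^sub>R act vs (\<alpha> s) + y *\<^sub>R act vs (\<alpha> t)"
      using linear_act[OF vsS] by (simp add: xy(4) linear_add linear_scale)
    also have "\<dots> \<in> PLC (\<alpha> ` S)"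
      using xy vp by (intro PLC_comb) auto
    finally show ?thesis .
  qed
qed

text \<open>Write the root with a reduced \<open>ws\<close>. If appending \<open>s\<close> shortens
  it, a reduced word \<open>vs\<close> for the product satisfies the length hypothesis of
  \<open>reduced_positive\<close>, and it sends \<open>\<alpha> s\<close> to
  \<open>- z\<close>.\<close>

lemma coxeter_condition_imp_signed:
  assumes cox: coxeter_condition and "z \<in> \<Phi>"
  shows "z \<in> PLC (\<alpha> ` S) \<or> - z \<in> PLC (\<alpha> ` S)"
proof -
  obtain ws0 s where z0: "z = act ws0 (\<alpha> s)" "set ws0 \<subseteq> S" "s \<in> S"
    using assms(2) unfolding root_system_eq by blast
  obtain ws where ws: "set ws \<subseteq> S" "act ws = act ws0" "reduced ws"
    using reduced_exists[OF z0(2)] by metis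
  then have z: "z = act ws (\<alpha> s)"
    by (simp add: z0)
  show ?thesis
  proof (cases "\<forall>vs. set vs \<subseteq> S \<longrightarrow> act vs = act (ws @ [s]) \<longrightarrow> length ws \<le> length vs")
    case True
    then show ?thesis
      using reduced_positive[OF cox ws(1,3) z0(3)] z by simp
  next
    case False
    then obtain vs0 where vs0: "set vs0 \<subseteq> S" "act vs0 = act (ws @ [s])" "length vs0 < length ws"
      by force
    obtain vs where vs: "set vs \<subseteq> S" "act vs = act vs0" "reduced vs" "length vs \<le> length vs0"
      using reduced_exists[OF vs0(1)] by metis
    have "act (vs @ [s]) = act ws"
      using vs(2) vs0(2) z0(3) by (simp add: fun_eq_iff)
    then have "act vs (\<alpha> s) \<in> PLC (\<alpha> ` S)"
      using ws(3) vs(4) vs0(3)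
      by (intro reduced_positive[OF cox vs(1,3) z0(3)]) (auto simp: reduced_def)
    moreover have "act vs (\<alpha> s) = - z"
      using vs(2) vs0(2) z0(3) z linear_act[OF ws(1)] by (simp add: r_self linear_neg)
    ultimately show ?thesis
      by simp
  qed
qed

lemma decomposition_iff_coxeter_condition:
  "\<Phi> = pos_roots W (\<alpha> ` S) \<union> neg_roots W (\<alpha> ` S) \<and>
     pos_roots W (\<alpha> ` S) \<inter> neg_roots W (\<alpha> ` S) = {} \<longleftrightarrow> coxeter_condition"
  unfolding decomposition_iff
  using signed_imp_coxeter_condition coxeter_condition_imp_signed by blast

end

section \<open>Application to both sides of the pairing\<close>

theorem theorem2p3:
  fixes B :: "'v1::real_vector \<Rightarrow> 'v2::real_vector \<Rightarrow> real"
    and S :: "'s set"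
    and \<alpha> :: "'s \<Rightarrow> 'v1"
    and \<beta> :: "'s \<Rightarrow> 'v2"
    and \<Pi>\<^sub>1 :: "'v1 set"
    and \<Pi>\<^sub>2 :: "'v2 set"
  assumes "bilinear B"
    and "bij_betw \<alpha> S \<Pi>\<^sub>1"
    and "bij_betw \<beta> S \<Pi>\<^sub>2"
    and "\<And>s. s \<in> S \<Longrightarrow> B (\<alpha> s) (\<beta> s) = 1"
    and "0 \<notin> PLC \<Pi>\<^sub>1"
    and "0 \<notin> PLC \<Pi>\<^sub>2"
    and "\<And>s. s \<in> S \<Longrightarrow> \<alpha> s \<notin> PLC (\<Pi>\<^sub>1 - {\<alpha> s})"
    and "\<And>s. s \<in> S \<Longrightarrow> \<beta> s \<notin> PLC (\<Pi>\<^sub>2 - {\<beta> s})"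
  shows
    "((root_system (W1 B \<alpha> \<beta> S) \<Pi>\<^sub>1 = pos_roots (W1 B \<alpha> \<beta> S) \<Pi>\<^sub>1 \<union> neg_roots (W1 B \<alpha> \<beta> S) \<Pi>\<^sub>1 \<and>
       pos_roots (W1 B \<alpha> \<beta> S) \<Pi>\<^sub>1 \<inter> neg_roots (W1 B \<alpha> \<beta> S) \<Pi>\<^sub>1 = {})
      \<longleftrightarrow>
      (root_system (W2 B \<alpha> \<beta> S) \<Pi>\<^sub>2 = pos_roots (W2 B \<alpha> \<beta> S) \<Pi>\<^sub>2 \<union> neg_roots (W2 B \<alpha> \<beta> S) \<Pi>\<^sub>2 \<and>
       pos_roots (W2 B \<alpha> \<beta> S) \<Pi>\<^sub>2 \<inter> neg_roots (W2 B \<alpha> \<beta> S) \<Pi>\<^sub>2 = {}))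
     \<and>
     ((root_system (W2 B \<alpha> \<beta> S) \<Pi>\<^sub>2 = pos_roots (W2 B \<alpha> \<beta> S) \<Pi>\<^sub>2 \<union> neg_roots (W2 B \<alpha> \<beta> S) \<Pi>\<^sub>2 \<and>
       pos_roots (W2 B \<alpha> \<beta> S) \<Pi>\<^sub>2 \<inter> neg_roots (W2 B \<alpha> \<beta> S) \<Pi>\<^sub>2 = {})
      \<longleftrightarrow>
      (\<forall>s\<in>S. \<forall>t\<in>S.
         (s \<noteq> t \<longrightarrow> B (\<alpha> s) (\<beta> t) \<le> 0 \<and> B (\<alpha> t) (\<beta> s) \<le> 0) \<and>
         (B (\<alpha> s) (\<beta> t) = 0 \<longleftrightarrow> B (\<alpha> t) (\<beta> s) = 0) \<and>
         ((\<exists>m::int. m \<ge> 2 \<and> B (\<alpha> s) (\<beta> t) * B (\<alpha> t) (\<beta> s) = (cos (pi / of_int m))\<^sup>2) \<or>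
          B (\<alpha> s) (\<beta> t) * B (\<alpha> t) (\<beta> s) \<ge> 1)))"
proof -
  have \<Pi>: "\<Pi>\<^sub>1 = \<alpha> ` S" "\<Pi>\<^sub>2 = \<beta> ` S" "inj_on \<alpha> S" "inj_on \<beta> S"
    using assms(2,3) by (auto simp: bij_betw_def)
  have lin: "linear (\<lambda>x. B x y)" "linear (\<lambda>y. B x y)" for x y
    using assms(1) by (auto simp: bilinear_def)
  interpret R1: reflection_family S \<alpha> "\<lambda>s x. B x (\<beta> s)"
    using assms(4,5,7) lin(1) \<Pi> by (intro reflection_family.intro) simp_all
  interpret R2: reflection_family S \<beta> "\<lambda>s y. B (\<alpha> s) y"
    using assms(4,6,8) lin(2) \<Pi> by (intro reflection_family.intro) simp_all
  have "R1.r = rho1 B \<alpha> \<beta>" "R2.r = rho2 B \<alpha> \<beta>"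
    by (simp_all add: fun_eq_iff R1.r_def R2.r_def rho1_def rho2_def)
  then have W: "R1.W = W1 B \<alpha> \<beta> S" "R2.W = W2 B \<alpha> \<beta> S"
    by (simp_all add: W1_def W2_def)
  \<comment> \<open>Changing sides swaps the two pairing values attached to \<open>s\<close> and
    \<open>t\<close>, and the condition is symmetric in them.\<close>
  have sym: "R1.coxeter_condition \<longleftrightarrow> R2.coxeter_condition"
    unfolding R1.coxeter_condition_def R2.coxeter_condition_def by (simp only: mult.commute) blast
  show ?thesis
    using R1.decomposition_iff_coxeter_condition R2.decomposition_iff_coxeter_condition
    unfolding W \<Pi> sym[symmetric] R1.coxeter_condition_def[symmetric] by blast
qed

end
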